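(* Let $A\subseteq\mathbb{R}$, let $T:A\times\mathcal{P}(\mathbb{R})\to\mathcal{P}(\mathbb{R})$, let $F\in\mathcal{P}(\mathbb{R})$, and let $\boldsymbol{\alpha}=(\alpha_1,\ldots,\alpha_n),\ \boldsymbol{\beta}=(\beta_1,\ldots,\beta_n)\in A^n$ satisfy $\alpha_i\le\beta_i$ for $i=1,\ldots,n$. Let $(X_1,\ldots,X_n)$ be a random vector with marginal distribution functions $F_{X_i}=T(\alpha_i,F)$ and with an Archimedean copula with generator $\psi_1$, and let $(Y_1,\ldots,Y_n)$ be a random vector with marginal distribution functions $F_{Y_i}=T(\beta_i,F)$ and with an Archimedean copula with generator $\psi_2$. Let $\phi_1,\phi_2$ be the inverses of $\psi_1,\psi_2$, and put $X_{n:n}(\boldsymbol{\alpha})=\max\{X_1,\ldots,X_n\}$, $Y_{n:n}(\boldsymbol{\beta})=\max\{Y_1,\ldots,Y_n\}$. 1. If $T$ is increasing in its first argument, that is, $\alpha\le\beta$ in $A$ implies $T(\alpha,F)(x)\le T(\beta,F)(x)$ for every $x\in\mathbb{R}$, and $\phi_2\circ\psi_1$ is super-additive, then $X_{n:n}(\boldsymbol{\alpha})\ge_{st}Y_{n:n}(\boldsymbol{\beta})$. 2. If $T$ is decreasing in its first argument, that is, $\alpha\le\beta$ in $A$ implies $T(\alpha,F)(x)\ge T(\beta,F)(x)$ for every $x\in\mathbb{R}$, and $\phi_1\circ\psi_2$ is super-additive, then $X_{n:n}(\boldsymbol{\alpha})\le_{st}Y_{n:n}(\boldsymbol{\beta}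)$.
   Context: $\mathcal{P}(\mathbb{R})$ is the set of all cumulative distribution functions on $\mathbb{R}$. For random variables, $X\le_{st}Y$ (equivalently $Y\ge_{st}X$) means $P(X>x)\le P(Y>x)$ for every $x\in\mathbb{R}$. A function $g$ on $[0,\infty)$ is super-additive if $g(x+y)\ge g(x)+g(y)$ for all $x,y\ge0$ (the value $+\infty$ is allowed). A function $f$ is $d$-monotone ($d\ge2$) on $(a,b)$ if it is differentiable up to order $d-2$ there, $(-1)^if^{(i)}\ge0$ for $i=0,\ldots,d-2$, and $(-1)^{d-2}f^{(d-2)}$ is nonincreasing and convex on $(a,b)$. Let $\psi:[0,\infty)\to[0,1]$ be continuous, $d$-monotone (for some $d\geq 2$) on $(0,\infty)$, with $\psi(0)=1$ and $\lim_{x\to\infty}\psi(x)=0$; its inverse is $\phi(v)=\psi^{-1}(v)=\sup\{x:\psi(x)>v\}$ (with $\sup\emptyset=0$; $\phi(0)$ may be $+\infty$, and $\psi(\infty)=0$). An $n$-dimensional copula $C_\psi$ is Archimedean with generator $\psi$ if $C_\psi(v_1,\ldots,v_n)=\psi(\phi(v_1)+\cdots+\phi(v_n))$ for all $v_i\in[0,1]$. A random vector $(X_1,\ldots,X_n)$ has copula $C$ if $P(X_1\le x_1,\ldots,X_n\le x_n)=C(F_{X_1}(x_1),\ldots,F_{X_n}(x_n))$ for all $x_1,\dots,x_n\in\mathbb{R}$. *)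

theory Defs
  imports "HOL-Probability.Probability"
begin

definition cdfs :: "(real \<Rightarrow> real) set" where
  "cdfs = {cdf \<mu> | \<mu>. real_distribution \<mu>}"

text \<open>The two random variables may live on different probability spaces.\<close>

definition st_le :: "'a measure \<Rightarrow> ('a \<Rightarrow> real) \<Rightarrow> 'b measure \<Rightarrow> ('b \<Rightarrow> real) \<Rightarrow> bool" where
  "st_le M X N Y \<longleftrightarrow> (\<forall>x. \<P>(\<omega> in M. X \<omega> > x) \<le> \<P>(\<omega> in N. Y \<omega> > x))"

definition superadditive :: "(real \<Rightarrow> ennreal) \<Rightarrow> bool" where
  "superadditive g \<longleftrightarrow> (\<forall>x\<ge>0. \<forall>y\<ge>0. g (x + y) \<ge> g x + g y)"

text \<open>Here \<open>S\<close> is meant to be an open interval, so that \<^const>\<open>deriv\<close> only depends on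
  the values of \<open>f\<close> on \<open>S\<close>.\<close>

definition d_monotone_on :: "nat \<Rightarrow> real set \<Rightarrow> (real \<Rightarrow> real) \<Rightarrow> bool" where
  "d_monotone_on d S f \<longleftrightarrow>
     (\<forall>i<d - 2. \<forall>x\<in>S. (deriv ^^ i) f differentiable (at x)) \<and>
     (\<forall>i\<le>d - 2. \<forall>x\<in>S. (-1) ^ i * (deriv ^^ i) f x \<ge> 0) \<and>
     antimono_on S (\<lambda>x. (-1) ^ (d - 2) * (deriv ^^ (d - 2)) f x) \<and>
     convex_on S (\<lambda>x. (-1) ^ (d - 2) * (deriv ^^ (d - 2)) f x)"

text \<open>A generator is a function on \<open>[0, \<infinity>)\<close>; its values at negative arguments are
  irrelevant throughout.\<close>

definition generator :: "(real \<Rightarrow> real) \<Rightarrow> bool" where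
  "generator \<psi> \<longleftrightarrow>
     \<psi> ` {0..} \<subseteq> {0..1} \<and> continuous_on {0..} \<psi> \<and>
     (\<exists>d\<ge>2. d_monotone_on d {0<..} \<psi>) \<and>
     \<psi> 0 = 1 \<and> (\<psi> \<longlongrightarrow> 0) at_top"

text \<open>The supremum is taken in \<^typ>\<open>ennreal\<close>, where the supremum of the empty set is \<open>0\<close>
  and that of an unbounded set is \<open>\<infinity>\<close>.\<close>

definition gen_inverse :: "(real \<Rightarrow> real) \<Rightarrow> real \<Rightarrow> ennreal" where
  "gen_inverse \<psi> v = Sup {ennreal x | x. x \<ge> 0 \<and> \<psi> x > v}"

definition gen_ext :: "(real \<Rightarrow> real) \<Rightarrow> ennreal \<Rightarrow> real" where
  "gen_ext \<psi> t = (if t = \<infinity> then 0 else \<psi> (enn2real t))"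

text \<open>A copula is the restriction to the unit cube of a joint distribution function whose
  margins are uniform on \<open>[0, 1]\<close>; its values outside the cube are irrelevant.\<close>

definition copula :: "(real ^ 'n \<Rightarrow> real) \<Rightarrow> bool" where
  "copula C \<longleftrightarrow>
     (\<exists>\<mu> :: (real ^ 'n) measure.
        prob_space \<mu> \<and> sets \<mu> = sets borel \<and>
        (\<forall>i. distr \<mu> borel (\<lambda>x. x $ i) = uniform_measure lborel {0..1}) \<and>
        (\<forall>v. (\<forall>i. v $ i \<in> {0..1}) \<longrightarrow> C v = measure \<mu> {x. \<forall>i. x $ i \<le> v $ i}))"

definition archimedean_copula :: "(real \<Rightarrow> real) \<Rightarrow> (real ^ 'n \<Rightarrow> real) \<Rightarrow> bool" where
  "archimedean_copula \<psi> C \<longleftrightarrow>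
     copula C \<and>
     (\<forall>v. (\<forall>i. v $ i \<in> {0..1}) \<longrightarrow>
        C v = gen_ext \<psi> (\<Sum>i\<in>UNIV. gen_inverse \<psi> (v $ i)))"

definition marginal_cdf :: "'a measure \<Rightarrow> ('a \<Rightarrow> real ^ 'n) \<Rightarrow> 'n \<Rightarrow> real \<Rightarrow> real" where
  "marginal_cdf M X i = cdf (distr M borel (\<lambda>\<omega>. X \<omega> $ i))"

definition has_copula :: "'a measure \<Rightarrow> ('a \<Rightarrow> real ^ 'n) \<Rightarrow> (real ^ 'n \<Rightarrow> real) \<Rightarrow> bool" where
  "has_copula M X C \<longleftrightarrow>
     (\<forall>x. \<P>(\<omega> in M. \<forall>i. X \<omega> $ i \<le> x $ i) = C (\<chi> i. marginal_cdf M X i (x $ i)))"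

definition vec_max :: "real ^ 'n \<Rightarrow> real" where
  "vec_max x = Max (range (\<lambda>i. x $ i))"

end

theory Submission
  imports Defs
begin

text \<open>With \<open>u\<^sub>i\<close> and \<open>w\<^sub>i\<close> the margins of \<open>X\<close> and \<open>Y\<close> at \<open>x\<close>, the maxima have
  distribution functions \<open>\<psi>\<^sub>1 (\<Sum> \<phi>\<^sub>1 u\<^sub>i)\<close> and \<open>\<psi>\<^sub>2 (\<Sum> \<phi>\<^sub>2 w\<^sub>i)\<close> at \<open>x\<close>. If \<open>u\<^sub>i \<le> w\<^sub>i\<close>
  and \<open>t\<^sub>i = \<phi>\<^sub>1 u\<^sub>i\<close>, super-additivity of \<open>\<phi>\<^sub>2 \<circ> \<psi>\<^sub>1\<close> gives
  \<open>\<phi>\<^sub>2 (\<psi>\<^sub>1 (\<Sum> t\<^sub>i)) \<ge> \<Sum> \<phi>\<^sub>2 (\<psi>\<^sub>1 t\<^sub>i) = \<Sum> \<phi>\<^sub>2 u\<^sub>i \<ge> \<Sum> \<phi>\<^sub>2 w\<^sub>i\<close>, and the decreasing function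
  \<open>\<psi>\<^sub>2\<close> turns this into \<open>\<psi>\<^sub>1 (\<Sum> \<phi>\<^sub>1 u\<^sub>i) \<le> \<psi>\<^sub>2 (\<Sum> \<phi>\<^sub>2 w\<^sub>i)\<close>. If some \<open>t\<^sub>i\<close> is infinite, the
  left-hand side is \<open>0\<close>.\<close>

lemma generator_bounds:
  assumes "generator \<psi>" "0 \<le> x"
  shows "0 \<le> \<psi> x" "\<psi> x \<le> 1"
  using assms unfolding generator_def by (auto simp: image_subset_iff)

text \<open>For \<open>d = 2\<close> antitonicity is part of d-monotonicity itself; for larger
  \<open>d\<close> it follows from the sign of the first derivative. Both work only on the open
  half-line, so the left endpoint \<open>x = 0\<close> is settled by \<open>\<psi> 0 = 1\<close> and
  the bound \<psi> \<le> 1.\<close>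

lemma generator_antimono:
  assumes gen: "generator \<psi>" and xy: "0 \<le> x" "x \<le> y"
  shows "\<psi> y \<le> \<psi> x"
proof (cases "x = 0")
  case True
  then show ?thesis
    using generator_bounds(2)[OF gen] gen xy by (simp add: generator_def)
next
  case False
  with xy have x: "0 < x" by simp
  obtain d where d: "d \<ge> 2" "d_monotone_on d {0<..} \<psi>"
    using gen by (auto simp: generator_def)
  show ?thesis
  proof (cases "d = 2")
    case True
    with d have "antimono_on {0<..} \<psi>"
      by (simp add: d_monotone_on_def)
    then show ?thesis
      using x xy by (auto simp: monotone_on_def)
  next
    case False
    with d have lt: "0 < d - 2" and le: "1 \<le> d - 2" by auto
    have diff: "\<psi> differentiable (at z)" if "0 < z" for z
      using d(2) lt that unfolding d_monotone_on_def
      by (metis funpow_0 greaterThan_iff)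
    have sgn: "deriv \<psi> z \<le> 0" if "0 < z" for z
    proof -
      have "(-1) ^ 1 * (deriv ^^ 1) \<psi> z \<ge> 0"
        using d(2) le that unfolding d_monotone_on_def by (metis greaterThan_iff)
      then show ?thesis by simp
    qed
    show ?thesis
    proof (rule DERIV_nonpos_imp_nonincreasing[OF xy(2)])
      fix z assume "x \<le> z" "z \<le> y"
      with x have "0 < z" by simp
      then show "\<exists>D. DERIV \<psi> z :> D \<and> D \<le> 0"
        using diff sgn DERIV_deriv_iff_real_differentiable by blast
    qed
  qed
qed

text \<open>The limit 0 at infinity yields a point where \<psi> lies below \<open>v\<close>, and the
  intermediate value theorem applies between 0 and that point. Only the value 0 may fail to be
  attained.\<close>

lemma generator_attains:
  assumes gen: "generator \<psi>" and v: "0 < v" "v \<le> 1"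
  obtains t where "0 \<le> t" "\<psi> t = v"
proof -
  have "eventually (\<lambda>x. \<psi> x < v) at_top"
    using gen v by (auto simp: generator_def intro: order_tendstoD)
  then obtain b where b: "\<And>x. b \<le> x \<Longrightarrow> \<psi> x < v"
    by (auto simp: eventually_at_top_linorder)
  have "continuous_on {0..max b 0} \<psi>"
    using gen by (auto simp: generator_def elim: continuous_on_subset)
  then have "\<exists>t. 0 \<le> t \<and> t \<le> max b 0 \<and> \<psi> t = v"
    using b[of "max b 0"] gen v by (intro IVT2') (auto simp: generator_def)
  with that show ?thesis by blast
qed

lemma gen_inverse_antimono: "v \<le> w \<Longrightarrow> gen_inverse \<psi> w \<le> gen_inverse \<psi> v"
  unfolding gen_inverse_def by (rule Sup_subset_mono) force

lemma gen_ext_antimono: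
  assumes "generator \<psi>" "s \<le> t"
  shows "gen_ext \<psi> t \<le> gen_ext \<psi> s"
proof (cases "t = \<infinity>")
  case True
  then show ?thesis
    using generator_bounds(1)[OF assms(1)] by (simp add: gen_ext_def)
next
  case False
  then have "t < \<infinity>" "s \<noteq> \<infinity>"
    using assms(2) by (auto simp: less_top top_unique)
  then show ?thesis
    using assms by (simp add: gen_ext_def generator_antimono enn2real_mono)
qed

text \<open>Continuity makes the supremum a genuine right inverse, even if \<psi> reaches 0 and
  stays there. If \<psi> never vanishes, the convention \<psi>(\<infinity>) = 0 covers
  \<open>v = 0\<close>.\<close>

lemma gen_ext_gen_inverse:
  assumes gen: "generator \<psi>" and v: "0 \<le> v" "v \<le> 1"
  shows "gen_ext \<psi> (gen_inverse \<psi> v) = v"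
proof (cases "\<exists>t\<ge>0. \<psi> t = v")
  case True
  then obtain t where t: "0 \<le> t" "\<psi> t = v" by blast
  \<comment> \<open>Any preimage \<open>t\<close> of \<open>v\<close> bounds the supremum, which is
    therefore a real number \<open>r\<close> to which \<psi> can be applied.\<close>
  have "gen_inverse \<psi> v \<le> ennreal t"
    unfolding gen_inverse_def
  proof (rule Sup_least, clarify)
    fix x assume "0 \<le> x" "v < \<psi> x"
    then have "x \<le> t"
      using generator_antimono[OF gen t(1), of x] t(2) by fastforce
    then show "ennreal x \<le> ennreal t" by (rule ennreal_leI)
  qed
  then obtain r where r: "0 \<le> r" "gen_inverse \<psi> v = ennreal r" "r \<le> t"
    using t(1) by (cases "gen_inverse \<psi> v") (auto simp: top_unique)
  have "v \<le> \<psi> r" using generator_antimono[OF gen r(1,3)] t by simp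
  moreover have "\<not> v < \<psi> r"
  proof
    \<comment> \<open>A value strictly between \<open>v\<close> and \<open>\<psi> r\<close> is taken
      at some \<open>y\<close> to the right of \<open>r\<close>. As \<open>y\<close> still belongs
      to the set whose supremum is \<open>r\<close>, it must equal \<open>r\<close>, although
      \<open>\<psi> y < \<psi> r\<close>.\<close>
    assume less: "v < \<psi> r"
    have "continuous_on {r..t} \<psi>"
      using gen r(1) by (auto simp: generator_def elim: continuous_on_subset)
    then have "\<exists>y. r \<le> y \<and> y \<le> t \<and> \<psi> y = (v + \<psi> r) / 2"
      using less t r by (intro IVT2') auto
    then obtain y where y: "r \<le> y" "\<psi> y = (v + \<psi> r) / 2" by blast
    with less r have "0 \<le> y" "v < \<psi> y" by auto
    then have "ennreal y \<le> gen_inverse \<psi> v"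
      unfolding gen_inverse_def by (intro Sup_upper) auto
    with r y have "y = r" by (simp add: ennreal_le_iff)
    with y less show False by simp
  qed
  ultimately show ?thesis using r by (simp add: gen_ext_def)
next
  case False
  then have v0: "v = 0"
    using generator_attains[OF gen _ v(2)] v(1) by (metis less_eq_real_def)
  have pos: "0 < \<psi> x" if "0 \<le> x" for x
    using False v0 that generator_bounds(1)[OF gen that] by (metis less_eq_real_def)
  have upper: "ennreal x \<le> gen_inverse \<psi> v" if "0 \<le> x" for x
    unfolding gen_inverse_def using pos[OF that] that v0 by (intro Sup_upper) auto
  \<comment> \<open>Since \<psi> is positive everywhere, the supremum runs over the whole half-line;
    a finite value \<open>r\<close> would have to dominate \<open>r + 1\<close>.\<close>
  have "gen_inverse \<psi> v = \<infinity>"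
  proof (cases "gen_inverse \<psi> v")
    case (real r)
    with upper[of "r + 1"] show ?thesis by (simp add: ennreal_le_iff)
  qed simp
  with v0 show ?thesis by (simp add: gen_ext_def)
qed

lemma superadditive_sum:
  assumes "superadditive g" "finite I" "\<And>i. i \<in> I \<Longrightarrow> 0 \<le> t i"
  shows "(\<Sum>i\<in>I. g (t i)) \<le> g (\<Sum>i\<in>I. t i)"
  using assms(2,3)
proof (induction I)
  case (insert i I)
  have "g (t i) + (\<Sum>j\<in>I. g (t j)) \<le> g (t i) + g (\<Sum>j\<in>I. t j)"
    using insert by (intro add_left_mono) auto
  also have "\<dots> \<le> g (t i + (\<Sum>j\<in>I. t j))"
    using assms(1) insert.prems by (auto simp: superadditive_def sum_nonneg)
  finally show ?case using insert.hyps by simp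
\<comment> \<open>The empty sum is 0, the least element of \<open>ennreal\<close>, so the base case
  asks nothing of \<open>g 0\<close>.\<close>
qed simp

lemma archimedean_le:
  fixes u w :: "'n \<Rightarrow> real"
  assumes gen: "generator \<psi>\<^sub>1" "generator \<psi>\<^sub>2"
    and super: "superadditive (gen_inverse \<psi>\<^sub>2 \<circ> \<psi>\<^sub>1)"
    and I: "finite I"
    and u: "\<And>i. i \<in> I \<Longrightarrow> 0 \<le> u i" and uw: "\<And>i. i \<in> I \<Longrightarrow> u i \<le> w i"
    and w: "\<And>i. i \<in> I \<Longrightarrow> w i \<le> 1"
  shows "gen_ext \<psi>\<^sub>1 (\<Sum>i\<in>I. gen_inverse \<psi>\<^sub>1 (u i)) \<le> gen_ext \<psi>\<^sub>2 (\<Sum>i\<in>I. gen_inverse \<psi>\<^sub>2 (w i))"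
proof (cases "\<exists>i\<in>I. gen_inverse \<psi>\<^sub>1 (u i) = \<infinity>")
  case True
  then have "(\<Sum>i\<in>I. gen_inverse \<psi>\<^sub>1 (u i)) = \<infinity>"
    using I by simp
  then show ?thesis
    using generator_bounds(1)[OF gen(2)] by (simp add: gen_ext_def)
next
  case False
  \<comment> \<open>Super-additivity speaks of real arguments, so the values of the first inverse,
    now all finite, are moved from \<open>ennreal\<close> to \<open>real\<close>.\<close>
  define t where "t i = enn2real (gen_inverse \<psi>\<^sub>1 (u i))" for i
  define s where "s = (\<Sum>i\<in>I. t i)"
  have t0: "0 \<le> t i" for i by (simp add: t_def)
  then have s0: "0 \<le> s" by (simp add: s_def sum_nonneg)
  have t: "gen_inverse \<psi>\<^sub>1 (u i) = ennreal (t i)" if "i \<in> I" for i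
    using False that by (simp add: t_def less_top)
  then have "(\<Sum>i\<in>I. gen_inverse \<psi>\<^sub>1 (u i)) = ennreal s"
    using t0 by (simp add: s_def)
  then have lhs: "gen_ext \<psi>\<^sub>1 (\<Sum>i\<in>I. gen_inverse \<psi>\<^sub>1 (u i)) = \<psi>\<^sub>1 s"
    using s0 by (simp add: gen_ext_def)
  have \<psi>t: "\<psi>\<^sub>1 (t i) = u i" if "i \<in> I" for i
    using gen_ext_gen_inverse[OF gen(1) u[OF that]] uw[OF that] w[OF that] t[OF that] t0[of i]
    by (simp add: gen_ext_def)
  have "(\<Sum>i\<in>I. gen_inverse \<psi>\<^sub>2 (w i)) \<le> (\<Sum>i\<in>I. gen_inverse \<psi>\<^sub>2 (u i))"
    by (intro sum_mono gen_inverse_antimono uw)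
  also have "\<dots> = (\<Sum>i\<in>I. (gen_inverse \<psi>\<^sub>2 \<circ> \<psi>\<^sub>1) (t i))"
    by (simp add: \<psi>t)
  also have "\<dots> \<le> gen_inverse \<psi>\<^sub>2 (\<psi>\<^sub>1 s)"
    using superadditive_sum[OF super I, of t] t0 by (simp add: s_def)
  finally have "gen_ext \<psi>\<^sub>2 (gen_inverse \<psi>\<^sub>2 (\<psi>\<^sub>1 s)) \<le> gen_ext \<psi>\<^sub>2 (\<Sum>i\<in>I. gen_inverse \<psi>\<^sub>2 (w i))"
    by (rule gen_ext_antimono[OF gen(2)])
  then show ?thesis
    using gen_ext_gen_inverse[OF gen(2) generator_bounds[OF gen(1) s0]] lhs by simp
qed

lemma marginal_cdf_bounds:
  assumes "prob_space M" "X \<in> borel_measurable M"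
  shows "0 \<le> marginal_cdf M X i x" "marginal_cdf M X i x \<le> 1"
proof -
  have "(\<lambda>\<omega>. X \<omega> $ i) \<in> borel_measurable M"
    by (rule measurable_compose[OF assms(2) borel_measurable_nth])
  then interpret prob_space "distr M borel (\<lambda>\<omega>. X \<omega> $ i)"
    by (rule prob_space.prob_space_distr[OF assms(1)])
  show "0 \<le> marginal_cdf M X i x" "marginal_cdf M X i x \<le> 1"
    by (simp_all add: marginal_cdf_def cdf_def)
qed

lemma prob_vec_max_gt:
  fixes X :: "'a \<Rightarrow> real ^ 'n"
  assumes M: "prob_space M" and X: "X \<in> borel_measurable M"
    and arch: "archimedean_copula \<psi> C" and cop: "has_copula M X C"
  shows "\<P>(\<omega> in M. vec_max (X \<omega>) > x) =
    1 - gen_ext \<psi> (\<Sum>i\<in>UNIV. gen_inverse \<psi> (marginal_cdf M X i x))"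
proof -
  interpret prob_space M by (rule M)
  have "(\<lambda>\<omega>. X \<omega> $ i) \<in> borel_measurable M" for i
    by (rule measurable_compose[OF X borel_measurable_nth])
  then have meas: "{\<omega> \<in> space M. \<forall>i. X \<omega> $ i \<le> x} \<in> events"
    by measurable
  have "\<P>(\<omega> in M. vec_max (X \<omega>) > x) = \<P>(\<omega> in M. \<not> (\<forall>i. X \<omega> $ i \<le> x))"
    by (intro arg_cong[where f = prob] Collect_cong)
      (auto simp: vec_max_def Max_gr_iff not_le)
  also have "\<dots> = 1 - \<P>(\<omega> in M. \<forall>i. X \<omega> $ i \<le> x)"
    using meas by (rule prob_neg)
  \<comment> \<open>The distribution function of the maximum at \<open>x\<close> is the joint one at
    the diagonal point \<open>(x, ..., x)\<close>.\<close>
  also have "\<P>(\<omega> in M. \<forall>i. X \<omega> $ i \<le> x) = C (\<chi> i. marginal_cdf M X i x)"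
    using cop[unfolded has_copula_def, rule_format, of "\<chi> i. x"] by simp
  also have "\<dots> = gen_ext \<psi> (\<Sum>i\<in>UNIV. gen_inverse \<psi> (marginal_cdf M X i x))"
    using arch[unfolded archimedean_copula_def] marginal_cdf_bounds[OF M X] by simp
  finally show ?thesis .
qed

text \<open>Larger margins give the maximum a larger distribution function, hence smaller tail
  probabilities. The transform \<open>T\<close> is left out so that both parts of the theorem are
  instances.\<close>

lemma st_le_vec_max:
  fixes X :: "'a \<Rightarrow> real ^ 'n" and Y :: "'b \<Rightarrow> real ^ 'n"
  assumes X: "prob_space M" "X \<in> borel_measurable M"
      "generator \<psi>\<^sub>1" "archimedean_copula \<psi>\<^sub>1 C\<^sub>1" "has_copula M X C\<^sub>1"
    and Y: "prob_space N" "Y \<in> borel_measurable N"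
      "generator \<psi>\<^sub>2" "archimedean_copula \<psi>\<^sub>2 C\<^sub>2" "has_copula N Y C\<^sub>2"
    and le: "\<And>i x. marginal_cdf M X i x \<le> marginal_cdf N Y i x"
    and super: "superadditive (gen_inverse \<psi>\<^sub>2 \<circ> \<psi>\<^sub>1)"
  shows "st_le N (\<lambda>\<omega>. vec_max (Y \<omega>)) M (\<lambda>\<omega>. vec_max (X \<omega>))"
  unfolding st_le_def prob_vec_max_gt[OF X(1,2,4,5)] prob_vec_max_gt[OF Y(1,2,4,5)]
  by (intro allI diff_left_mono archimedean_le X Y super le finite
      marginal_cdf_bounds(1)[OF X(1,2)] marginal_cdf_bounds(2)[OF Y(1,2)])

theorem theorem3p1:
  fixes A :: "real set"
    and T :: "real \<Rightarrow> (real \<Rightarrow> real) \<Rightarrow> (real \<Rightarrow> real)"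
    and F :: "real \<Rightarrow> real"
    and \<alpha> \<beta> :: "real ^ 'n"
    and M :: "'a measure" and X :: "'a \<Rightarrow> real ^ 'n"
    and N :: "'b measure" and Y :: "'b \<Rightarrow> real ^ 'n"
    and \<psi>\<^sub>1 \<psi>\<^sub>2 :: "real \<Rightarrow> real"
    and C\<^sub>1 C\<^sub>2 :: "real ^ 'n \<Rightarrow> real"
  assumes "T \<in> A \<rightarrow> (cdfs \<rightarrow> cdfs)"
    and "F \<in> cdfs"
    and "\<And>i. \<alpha> $ i \<in> A" and "\<And>i. \<beta> $ i \<in> A"
    and "\<And>i. \<alpha> $ i \<le> \<beta> $ i"
    and "prob_space M" and "X \<in> borel_measurable M"
    and "\<And>i. marginal_cdf M X i = T (\<alpha> $ i) F"
    and "generator \<psi>\<^sub>1" and "archimedean_copula \<psi>\<^sub>1 C\<^sub>1" and "has_copula M X C\<^sub>1"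
    and "prob_space N" and "Y \<in> borel_measurable N"
    and "\<And>i. marginal_cdf N Y i = T (\<beta> $ i) F"
    and "generator \<psi>\<^sub>2" and "archimedean_copula \<psi>\<^sub>2 C\<^sub>2" and "has_copula N Y C\<^sub>2"
  shows "((\<forall>a\<in>A. \<forall>b\<in>A. a \<le> b \<longrightarrow> (\<forall>x. T a F x \<le> T b F x)) \<and>
            superadditive (gen_inverse \<psi>\<^sub>2 \<circ> \<psi>\<^sub>1)
          \<longrightarrow> st_le N (\<lambda>\<omega>. vec_max (Y \<omega>)) M (\<lambda>\<omega>. vec_max (X \<omega>))) \<and>
         ((\<forall>a\<in>A. \<forall>b\<in>A. a \<le> b \<longrightarrow> (\<forall>x. T a F x \<ge> T b F x)) \<and>
            superadditive (gen_inverse \<psi>\<^sub>1 \<circ> \<psi>\<^sub>2)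
          \<longrightarrow> st_le M (\<lambda>\<omega>. vec_max (X \<omega>)) N (\<lambda>\<omega>. vec_max (Y \<omega>)))"
proof (intro conjI impI; elim conjE)
  assume inc: "\<forall>a\<in>A. \<forall>b\<in>A. a \<le> b \<longrightarrow> (\<forall>x. T a F x \<le> T b F x)"
    and super: "superadditive (gen_inverse \<psi>\<^sub>2 \<circ> \<psi>\<^sub>1)"
  have "marginal_cdf M X i x \<le> marginal_cdf N Y i x" for i x
    using inc assms(3-5) by (simp add: assms(8,14))
  then show "st_le N (\<lambda>\<omega>. vec_max (Y \<omega>)) M (\<lambda>\<omega>. vec_max (X \<omega>))"
    using st_le_vec_max[OF assms(6,7,9-13,15-17)] super by blast
next
  assume dec: "\<forall>a\<in>A. \<forall>b\<in>A. a \<le> b \<longrightarrow> (\<forall>x. T a F x \<ge> T b F x)"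
    and super: "superadditive (gen_inverse \<psi>\<^sub>1 \<circ> \<psi>\<^sub>2)"
  have "marginal_cdf N Y i x \<le> marginal_cdf M X i x" for i x
    using dec assms(3-5) by (simp add: assms(8,14))
  then show "st_le M (\<lambda>\<omega>. vec_max (X \<omega>)) N (\<lambda>\<omega>. vec_max (Y \<omega>))"
    \<comment> \<open>A decreasing \<open>T\<close> reverses the order of the margins, so the two
      vectors exchange roles.\<close>
    using st_le_vec_max[OF assms(12,13,15-17,6,7,9-11)] super by blast
qed

end
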